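(* For the DCPD algorithm applied to a tensor $\mathcal{T}\in\mathbb{K}^{I_1\times\cdots\times I_N}$ with rank parameter $R$, for any $l>1$ and $c_l=\prod_{r=1}^{R}\sin(\gamma[r,l])$, the inequality $$\|\mathcal{E}[R,l]\|\le c_l\,\|\mathcal{E}[R,l-1]\|$$ holds.
   Context: $\mathbb{K}\in\{\mathbb{R},\mathbb{C}\}$. $\langle\mathcal{T},\mathcal{U}\rangle=\sum T_{i_1\cdots i_N}U^*_{i_1\cdots i_N}$ and $\|\cdot\|$ is the induced Frobenius norm. $\phi$ is a best rank-1 approximation operator: $\phi(\mathcal{Y})$ minimizes $\|\mathcal{Y}-\mathcal{Z}\|$ over tensors $\mathcal{Z}$ of rank at most 1. DCPD algorithm. Initialization: $\mathcal{Y}[1,1]=\mathcal{T}$; for $r=1,\dots,R$ set $\mathcal{X}[r,1]=\phi(\mathcal{Y}[r,1])$, and $\mathcal{Y}[r+1,1]=\mathcal{Y}[r,1]-\mathcal{X}[r,1]$ if $r<R$; $\mathcal{E}[R,1]=\mathcal{Y}[R,1]-\mathcal{X}[R,1]$. For $l\ge2$ and successively $r=1,\dots,R$: $\mathcal{Y}[1,l]=\mathcal{X}[1,l-1]+\mathcal{E}[R,l-1]$, and $\mathcal{Y}[r,l]=\mathcal{X}[r,l-1]+\mathcal{E}[r-1,l]$ if $r>1$; then $\mathcal{X}[r,l]=\phi(\mathcal{Y}[r,l])$ and $\mathcal{E}[r,l]=\mathcal{Y}[r,l]-\mathcal{X}[r,l]$. The angle between nonzero tensors $\mathcal{U},\mathcal{V}$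 is $\arccos\big(|\langle\mathcal{U},\mathcal{V}\rangle|/(\|\mathcal{U}\|\|\mathcal{V}\|)\big)\in[0,\pi/2]$, and is taken to be $\pi/2$ if one of them is zero. For $l>1$: $\gamma[r,l]$ is the angle between $\mathcal{E}[r-1,l]$ and $\mathcal{X}[r,l-1]$ if $1<r\le R$, and $\gamma[1,l]$ is the angle between $\mathcal{E}[R,l-1]$ and $\mathcal{X}[1,l-1]$. *)

theory Defs
  imports Complex_Main "HOL-Library.FuncSet" "HOL-Library.Function_Algebras"
begin

text \<open>
  The ground field \<open>K\<close> is a set of complex numbers, either \<open>\<real>\<close> or \<open>UNIV\<close>, so that both cases
  share the same definitions; complex conjugation is the identity on \<open>\<real>\<close>.
  A tensor of format \<open>I 1 \<times> \<dots> \<times> I N\<close> is a function on multi-indices (1-based, as in \<open>multi_indices\<close>)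
  that is extended by zero, so that equality and the pointwise operations of
  \<open>Function_Algebras\<close> on such functions are those of the tensor space.
\<close>

type_synonym tensor = "(nat \<Rightarrow> nat) \<Rightarrow> complex"

definition multi_indices :: "nat \<Rightarrow> (nat \<Rightarrow> nat) \<Rightarrow> (nat \<Rightarrow> nat) set" where
  "multi_indices N I = (\<Pi>\<^sub>E n\<in>{1..N}. {1..I n})"

definition tensors :: "complex set \<Rightarrow> nat \<Rightarrow> (nat \<Rightarrow> nat) \<Rightarrow> tensor set" where
  "tensors K N I =
    {T. (\<forall>i \<in> multi_indices N I. T i \<in> K) \<and> (\<forall>i. i \<notin> multi_indices N I \<longrightarrow> T i = 0)}"

definition tensor_inner :: "nat \<Rightarrow> (nat \<Rightarrow> nat) \<Rightarrow> tensor \<Rightarrow> tensor \<Rightarrow> complex" where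
  "tensor_inner N I T U = (\<Sum>i\<in>multi_indices N I. T i * cnj (U i))"

definition tensor_norm :: "nat \<Rightarrow> (nat \<Rightarrow> nat) \<Rightarrow> tensor \<Rightarrow> real" where
  "tensor_norm N I T = sqrt (Re (tensor_inner N I T T))"

definition outer_product :: "nat \<Rightarrow> (nat \<Rightarrow> nat) \<Rightarrow> (nat \<Rightarrow> nat \<Rightarrow> complex) \<Rightarrow> tensor" where
  "outer_product N I a = (\<lambda>i. if i \<in> multi_indices N I then \<Prod>n=1..N. a n (i n) else 0)"

definition rank_one :: "complex set \<Rightarrow> nat \<Rightarrow> (nat \<Rightarrow> nat) \<Rightarrow> tensor \<Rightarrow> bool" where
  "rank_one K N I Z \<longleftrightarrow>
    (\<exists>a. (\<forall>n\<in>{1..N}. (\<forall>j\<in>{1..I n}. a n j \<in> K) \<and> (\<exists>j\<in>{1..I n}. a n j \<noteq> 0)) \<and>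
         Z = outer_product N I a)"

text \<open>The rank is taken over \<open>K\<close>. For \<open>N \<ge> 1\<close> every element of \<open>tensors K N I\<close> is a finite sum of
  rank-one tensors, so the minimum exists; the zero tensor is the empty sum.\<close>

definition tensor_rank :: "complex set \<Rightarrow> nat \<Rightarrow> (nat \<Rightarrow> nat) \<Rightarrow> tensor \<Rightarrow> nat" where
  "tensor_rank K N I T =
    (LEAST r. \<exists>Z. (\<forall>j<r. rank_one K N I (Z j)) \<and> T = (\<Sum>j<r. Z j))"

definition best_rank_one_operator ::
    "complex set \<Rightarrow> nat \<Rightarrow> (nat \<Rightarrow> nat) \<Rightarrow> (tensor \<Rightarrow> tensor) \<Rightarrow> bool" where
  "best_rank_one_operator K N I \<phi> \<longleftrightarrow>
    (\<forall>Y \<in> tensors K N I.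
       \<phi> Y \<in> tensors K N I \<and> tensor_rank K N I (\<phi> Y) \<le> 1 \<and>
       (\<forall>Z \<in> tensors K N I. tensor_rank K N I Z \<le> 1 \<longrightarrow>
          tensor_norm N I (Y - \<phi> Y) \<le> tensor_norm N I (Y - Z)))"

text \<open>\<open>X r l\<close>, \<open>Y r l\<close>, \<open>E r l\<close> are the tensors produced by the algorithm, for \<open>1 \<le> r \<le> R\<close> and
  \<open>l \<ge> 1\<close>. The equations determine them uniquely, except that \<open>E r 1\<close> is not defined (and not used)
  for \<open>r < R\<close>.\<close>

definition dcpd ::
    "(tensor \<Rightarrow> tensor) \<Rightarrow> nat \<Rightarrow> tensor \<Rightarrow>
     (nat \<Rightarrow> nat \<Rightarrow> tensor) \<Rightarrow> (nat \<Rightarrow> nat \<Rightarrow> tensor) \<Rightarrow> (nat \<Rightarrow> nat \<Rightarrow> tensor) \<Rightarrow> bool" where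
  "dcpd \<phi> R T X Y E \<longleftrightarrow>
     Y 1 1 = T \<and>
     (\<forall>r\<in>{1..R}. X r 1 = \<phi> (Y r 1)) \<and>
     (\<forall>r\<in>{1..<R}. Y (r + 1) 1 = Y r 1 - X r 1) \<and>
     E R 1 = Y R 1 - X R 1 \<and>
     (\<forall>l\<ge>2. Y 1 l = X 1 (l - 1) + E R (l - 1)) \<and>
     (\<forall>l\<ge>2. \<forall>r\<in>{2..R}. Y r l = X r (l - 1) + E (r - 1) l) \<and>
     (\<forall>l\<ge>2. \<forall>r\<in>{1..R}. X r l = \<phi> (Y r l) \<and> E r l = Y r l - X r l)"

definition tensor_angle :: "nat \<Rightarrow> (nat \<Rightarrow> nat) \<Rightarrow> tensor \<Rightarrow> tensor \<Rightarrow> real" where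
  "tensor_angle N I U V =
    (if U = 0 \<or> V = 0 then pi / 2
     else arccos (cmod (tensor_inner N I U V) / (tensor_norm N I U * tensor_norm N I V)))"

definition dcpd_angle ::
    "nat \<Rightarrow> (nat \<Rightarrow> nat) \<Rightarrow> nat \<Rightarrow> (nat \<Rightarrow> nat \<Rightarrow> tensor) \<Rightarrow> (nat \<Rightarrow> nat \<Rightarrow> tensor) \<Rightarrow>
     nat \<Rightarrow> nat \<Rightarrow> real" where
  "dcpd_angle N I R X E r l =
    (if r = 1 then tensor_angle N I (E R (l - 1)) (X 1 (l - 1))
     else tensor_angle N I (E (r - 1) l) (X r (l - 1)))"

end

theory Submission imports Defs begin

text \<open>
  Every update of the algorithm removes from \<open>Y = X + E\<close> a best rank-one approximation, where \<open>X\<close>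
  is the previous value of the component, hence itself of rank at most one. All scalar multiples
  of \<open>X\<close> compete with \<open>\<phi> Y\<close>, so the new residual is no longer than the distance from \<open>Y\<close> to the
  line \<open>K X\<close>. Since \<open>Y\<close> and \<open>E\<close> differ by a point of that line, this is also the distance from
  \<open>E\<close> to the line, which is \<open>sin \<gamma> * \<parallel>E\<parallel>\<close> with \<open>\<gamma>\<close> the angle between \<open>E\<close> and \<open>X\<close>
  (\<open>best_approximation_residual_le\<close>). One sweep performs \<open>R\<close> such updates, each starting from the
  residual left by the one before, so the factors \<open>sin \<gamma>\<close> multiply (\<open>sweep_residual_le\<close>).
\<close>

section \<open>Arithmetic of tensors\<close>

lemma tensors_add:
  assumes "K = \<real> \<or> K = UNIV" "T \<in> tensors K N I" "U \<in> tensors K N I"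
  shows "T + U \<in> tensors K N I"
  using assms by (auto simp: tensors_def)

lemma tensors_diff:
  assumes "K = \<real> \<or> K = UNIV" "T \<in> tensors K N I" "U \<in> tensors K N I"
  shows "T - U \<in> tensors K N I"
  using assms by (auto simp: tensors_def)

lemma tensors_scale:
  assumes "K = \<real> \<or> K = UNIV" "t \<in> K" "T \<in> tensors K N I"
  shows "(\<lambda>i. t * T i) \<in> tensors K N I"
  using assms by (auto simp: tensors_def)

lemma tensor_inner_in_field:
  assumes "K = \<real> \<or> K = UNIV" "T \<in> tensors K N I" "U \<in> tensors K N I"
  shows "tensor_inner N I T U \<in> K"
  using assms unfolding tensor_inner_def tensors_def
  by (auto intro!: sum_in_Reals Reals_mult simp: Reals_cnj_iff)

lemma finite_multi_indices: "finite (multi_indices N I)"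
  unfolding multi_indices_def by (intro finite_PiE) auto

section \<open>The distance from a tensor to a line\<close>

lemma tensor_inner_commute: "tensor_inner N I U T = cnj (tensor_inner N I T U)"
  by (simp add: tensor_inner_def mult.commute)

lemma tensor_inner_diff_scale:
  "tensor_inner N I (U - (\<lambda>i. s * V i)) (U - (\<lambda>i. s * V i)) =
     tensor_inner N I U U - cnj s * tensor_inner N I U V - s * tensor_inner N I V U
       + s * cnj s * tensor_inner N I V V"
  by (simp add: tensor_inner_def sum_distrib_left flip: sum_subtractf sum.distrib)
    (simp add: algebra_simps)

lemma tensor_inner_self: "tensor_inner N I T T = of_real (\<Sum>i\<in>multi_indices N I. (cmod (T i))\<^sup>2)"
  by (simp only: tensor_inner_def of_real_sum complex_norm_square)

lemma tensor_norm_nonneg: "tensor_norm N I T \<ge> 0"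
  by (simp add: tensor_norm_def tensor_inner_self sum_nonneg)

lemma tensor_inner_self_eq_norm: "tensor_inner N I T T = of_real ((tensor_norm N I T)\<^sup>2)"
  by (simp add: tensor_norm_def tensor_inner_self sum_nonneg)

lemma tensor_norm_pos:
  assumes "T \<in> tensors K N I" "T \<noteq> 0"
  shows "tensor_norm N I T > 0"
proof -
  obtain i where i: "T i \<noteq> 0" using assms(2) by (auto simp: fun_eq_iff)
  hence "i \<in> multi_indices N I" using assms(1) by (auto simp: tensors_def)
  hence "(\<Sum>i\<in>multi_indices N I. (cmod (T i))\<^sup>2) > 0"
    using i by (intro sum_pos2[OF finite_multi_indices]) auto
  thus ?thesis by (simp add: tensor_norm_def tensor_inner_self)
qed

text \<open>Pythagoras: the coefficient of \<open>V\<close> is that of the orthogonal projection of \<open>U\<close> onto the line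
  spanned by \<open>V\<close>.\<close>

lemma tensor_norm_orthogonal_residual:
  assumes V: "tensor_norm N I V > 0"
    and s: "s = tensor_inner N I U V / of_real ((tensor_norm N I V)\<^sup>2)"
  shows "(tensor_norm N I (U - (\<lambda>i. s * V i)))\<^sup>2 =
    (tensor_norm N I U)\<^sup>2 - (cmod (tensor_inner N I U V))\<^sup>2 / (tensor_norm N I V)\<^sup>2"
proof -
  define p where "p = tensor_inner N I U V"
  define a where "a = (tensor_norm N I V)\<^sup>2"
  have a: "a > 0" using V by (simp add: a_def)
  have "tensor_inner N I (U - (\<lambda>i. s * V i)) (U - (\<lambda>i. s * V i)) =
      of_real ((tensor_norm N I U)\<^sup>2) - cnj (p / of_real a) * p - p / of_real a * cnj p
        + p / of_real a * cnj (p / of_real a) * of_real a"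
    unfolding tensor_inner_diff_scale tensor_inner_commute[of N I V U]
    by (simp add: tensor_inner_self_eq_norm s p_def a_def)
  also have "\<dots> = of_real ((tensor_norm N I U)\<^sup>2) - p * cnj p / of_real a"
    using a by (simp add: field_simps)
  also have "\<dots> = of_real ((tensor_norm N I U)\<^sup>2 - (cmod p)\<^sup>2 / a)"
    by (simp flip: complex_norm_square)
  finally show ?thesis
    unfolding tensor_inner_self_eq_norm of_real_eq_iff by (simp add: p_def a_def)
qed

text \<open>Orthogonal residuals have nonnegative squared norm.\<close>

lemma tensor_Cauchy_Schwarz:
  assumes "tensor_norm N I V > 0"
  shows "cmod (tensor_inner N I U V) \<le> tensor_norm N I U * tensor_norm N I V"
proof -
  have "0 \<le> (tensor_norm N I U)\<^sup>2 - (cmod (tensor_inner N I U V))\<^sup>2 / (tensor_norm N I V)\<^sup>2"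
    using tensor_norm_orthogonal_residual[OF assms refl, of U] by (metis zero_le_power2)
  hence "(cmod (tensor_inner N I U V))\<^sup>2 \<le> (tensor_norm N I U * tensor_norm N I V)\<^sup>2"
    using assms by (simp add: field_simps)
  thus ?thesis
    by (rule power2_le_imp_le) (simp add: tensor_norm_nonneg)
qed

lemma cos_tensor_angle_le_1:
  assumes "tensor_norm N I U > 0" "tensor_norm N I V > 0"
  shows "cmod (tensor_inner N I U V) / (tensor_norm N I U * tensor_norm N I V) \<le> 1"
  using tensor_Cauchy_Schwarz[OF assms(2), of U] assms by (simp add: field_simps)

lemma sin_tensor_angle_nonneg:
  assumes "U \<in> tensors K N I" "V \<in> tensors K N I"
  shows "sin (tensor_angle N I U V) \<ge> 0"
proof (cases "U = 0 \<or> V = 0")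
  case True
  thus ?thesis by (simp add: tensor_angle_def)
next
  case False
  hence "tensor_norm N I U > 0" "tensor_norm N I V > 0"
    using assms by (auto intro: tensor_norm_pos)
  note cos_tensor_angle_le_1[OF this]
  moreover have "0 \<le> cmod (tensor_inner N I U V) / (tensor_norm N I U * tensor_norm N I V)"
    by (simp add: tensor_norm_nonneg)
  ultimately show ?thesis
    unfolding tensor_angle_def if_not_P[OF False]
    by (intro sin_ge_zero arccos_lbound arccos_ubound) linarith+
qed

text \<open>The sine of the angle is the relative length of the component of \<open>U\<close> orthogonal to \<open>V\<close>. The
  coefficient of \<open>V\<close> is a quotient of elements of \<open>K\<close>, so over the reals the foot of the
  perpendicular is again a real tensor.\<close>

lemma sin_tensor_angle_eq_distance:
  assumes K: "K = \<real> \<or> K = UNIV" and "U \<in> tensors K N I" "V \<in> tensors K N I" "U \<noteq> 0" "V \<noteq> 0"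
  shows "\<exists>s\<in>K. tensor_norm N I (U - (\<lambda>i. s * V i)) =
    sin (tensor_angle N I U V) * tensor_norm N I U"
proof -
  define s where "s = tensor_inner N I U V / of_real ((tensor_norm N I V)\<^sup>2)"
  define q where "q = cmod (tensor_inner N I U V) / (tensor_norm N I U * tensor_norm N I V)"
  have U: "tensor_norm N I U > 0" and V: "tensor_norm N I V > 0"
    using assms by (auto intro: tensor_norm_pos)
  have "s \<in> K"
    using K tensor_inner_in_field[OF assms(1-3)] by (auto simp: s_def intro!: Reals_divide)
  have q: "0 \<le> q" "q \<le> 1"
    using cos_tensor_angle_le_1[OF U V] by (auto simp: q_def tensor_norm_nonneg)
  have "(tensor_norm N I (U - (\<lambda>i. s * V i)))\<^sup>2 = (1 - q\<^sup>2) * (tensor_norm N I U)\<^sup>2"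
    using U V unfolding tensor_norm_orthogonal_residual[OF V s_def] q_def
    by (simp add: field_simps)
  also have "1 - q\<^sup>2 = (sin (tensor_angle N I U V))\<^sup>2"
    using q assms(4,5) by (simp add: tensor_angle_def sin_squared_eq flip: q_def)
  finally have "(tensor_norm N I (U - (\<lambda>i. s * V i)))\<^sup>2 =
      (sin (tensor_angle N I U V) * tensor_norm N I U)\<^sup>2"
    unfolding power_mult_distrib .
  hence "tensor_norm N I (U - (\<lambda>i. s * V i)) = sin (tensor_angle N I U V) * tensor_norm N I U"
    by (rule power2_eq_imp_eq)
      (intro tensor_norm_nonneg mult_nonneg_nonneg sin_tensor_angle_nonneg[OF assms(2,3)])+
  with \<open>s \<in> K\<close> show ?thesis by blast
qed

section \<open>Scalar multiples of tensors of rank at most one\<close>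

text \<open>The scalar is absorbed into the first factor of the outer product, which exists as
  \<open>N \<ge> 1\<close>.\<close>

lemma rank_one_scale:
  assumes K: "K = \<real> \<or> K = UNIV" and N: "N \<ge> 1" and t: "t \<in> K" "t \<noteq> 0" and Z: "rank_one K N I Z"
  shows "rank_one K N I (\<lambda>i. t * Z i)"
proof -
  from Z obtain a where a: "\<forall>n\<in>{1..N}. (\<forall>j\<in>{1..I n}. a n j \<in> K) \<and> (\<exists>j\<in>{1..I n}. a n j \<noteq> 0)"
    and Z: "Z = outer_product N I a"
    unfolding rank_one_def by blast
  define b where "b = (\<lambda>n j. (if n = 1 then t else 1) * a n j)"
  have "(\<Prod>n=1..N. b n (i n)) = t * (\<Prod>n=1..N. a n (i n))" for i
    using N by (simp add: b_def prod.distrib prod.delta)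
  hence "(\<lambda>i. t * Z i) = outer_product N I b"
    by (auto simp: Z outer_product_def)
  moreover have "\<forall>n\<in>{1..N}. (\<forall>j\<in>{1..I n}. b n j \<in> K) \<and> (\<exists>j\<in>{1..I n}. b n j \<noteq> 0)"
    using a K t by (auto simp: b_def)
  ultimately show ?thesis
    unfolding rank_one_def by blast
qed

lemma rank_one_sum_scale:
  fixes r :: nat
  assumes "K = \<real> \<or> K = UNIV" "N \<ge> 1" "t \<in> K" "t \<noteq> 0"
    and "\<exists>Z. (\<forall>j<r. rank_one K N I (Z j)) \<and> T = (\<Sum>j<r. Z j)"
  shows "\<exists>Z. (\<forall>j<r. rank_one K N I (Z j)) \<and> (\<lambda>i. t * T i) = (\<Sum>j<r. Z j)"
proof -
  from assms(5) obtain Z where Z: "\<forall>j<r. rank_one K N I (Z j)" "T = (\<Sum>j<r. Z j)" by blast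
  have "(\<lambda>i. t * (\<Sum>j<r. Z j) i) = (\<Sum>j<r. (\<lambda>i. t * Z j i))"
    by (induction r) (auto simp: fun_eq_iff algebra_simps)
  with Z rank_one_scale[OF assms(1-4)] show ?thesis
    by (intro exI[of _ "\<lambda>j i. t * Z j i"]) auto
qed

text \<open>Scaling the summands by \<open>t\<close> or by \<open>inverse t\<close> turns decompositions of either tensor into
  decompositions of the other of the same length, so both minima range over the same set.\<close>

lemma tensor_rank_scale:
  assumes K: "K = \<real> \<or> K = UNIV" and N: "N \<ge> 1" and t: "t \<in> K" "t \<noteq> 0"
  shows "tensor_rank K N I (\<lambda>i. t * T i) = tensor_rank K N I T"
proof -
  have inv: "inverse t \<in> K" "inverse t \<noteq> 0" using K t by auto
  have T: "(\<lambda>i. inverse t * (t * T i)) = T"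
    using t by (simp add: mult.assoc[symmetric])
  have "(\<exists>Z. (\<forall>j<r. rank_one K N I (Z j)) \<and> (\<lambda>i. t * T i) = (\<Sum>j<r. Z j)) \<longleftrightarrow>
        (\<exists>Z. (\<forall>j<r. rank_one K N I (Z j)) \<and> T = (\<Sum>j<r. Z j))" (is "?L \<longleftrightarrow> ?R") for r :: nat
  proof
    show ?R if ?L
      using rank_one_sum_scale[OF K N inv that] unfolding T .
    show ?L if ?R
      by (rule rank_one_sum_scale[OF K N t that])
  qed
  thus ?thesis unfolding tensor_rank_def by simp
qed

lemma tensor_rank_zero: "tensor_rank K N I 0 = 0"
  unfolding tensor_rank_def by (rule Least_eq_0) simp

lemma tensor_rank_scale_le_one:
  assumes "K = \<real> \<or> K = UNIV" "N \<ge> 1" "t \<in> K" "tensor_rank K N I T \<le> 1"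
  shows "tensor_rank K N I (\<lambda>i. t * T i) \<le> 1"
proof (cases "t = 0")
  case True
  hence "(\<lambda>i. t * T i) = 0" by (auto simp: fun_eq_iff)
  thus ?thesis by (simp add: tensor_rank_zero)
qed (use assms tensor_rank_scale[of K N t I T] in simp)

section \<open>Contraction of the residual\<close>

lemma best_approximation_residual_le:
  assumes K: "K = \<real> \<or> K = UNIV" and N: "N \<ge> 1" and \<phi>: "best_rank_one_operator K N I \<phi>"
    and X: "X \<in> tensors K N I" "tensor_rank K N I X \<le> 1" and E: "E \<in> tensors K N I"
  shows "tensor_norm N I (X + E - \<phi> (X + E)) \<le> sin (tensor_angle N I E X) * tensor_norm N I E"
proof -
  have best: "tensor_norm N I (X + E - \<phi> (X + E)) \<le> tensor_norm N I (X + E - Z)"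
    if "Z \<in> tensors K N I" "tensor_rank K N I Z \<le> 1" for Z
    using \<phi> that tensors_add[OF K X(1) E] unfolding best_rank_one_operator_def by blast
  show ?thesis
  proof (cases "E = 0 \<or> X = 0")
    case True
    \<comment> \<open>The angle is \<open>pi / 2\<close>, and the old component \<open>X\<close> itself is a good enough competitor.\<close>
    thus ?thesis using best[OF X] by (simp add: tensor_angle_def)
  next
    case False
    then obtain s where s: "s \<in> K" and dist:
      "tensor_norm N I (E - (\<lambda>i. s * X i)) = sin (tensor_angle N I E X) * tensor_norm N I E"
      using sin_tensor_angle_eq_distance[OF K E X(1)] by blast
    \<comment> \<open>The foot of the perpendicular from \<open>X + E\<close> to the line through \<open>X\<close>.\<close>
    define Z where "Z = (\<lambda>i. (1 + s) * X i)"
    have "1 + s \<in> K" using K s by auto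
    hence "tensor_norm N I (X + E - \<phi> (X + E)) \<le> tensor_norm N I (X + E - Z)"
      unfolding Z_def
      by (intro best tensors_scale[OF K] tensor_rank_scale_le_one[OF K N]) (use X in auto)
    also have "X + E - Z = E - (\<lambda>i. s * X i)"
      by (auto simp: Z_def fun_eq_iff algebra_simps)
    finally show ?thesis unfolding dist .
  qed
qed

text \<open>One sweep in abstract form: \<open>e 0\<close> is the residual left by the previous sweep and \<open>x r\<close> are
  the components it left behind. The bounds for single updates can be chained because the sines are
  nonnegative.\<close>

lemma sweep_residual_le:
  fixes e x :: "nat \<Rightarrow> tensor"
  assumes K: "K = \<real> \<or> K = UNIV" and N: "N \<ge> 1" and \<phi>: "best_rank_one_operator K N I \<phi>"
    and x: "\<And>r. r \<in> {1..R} \<Longrightarrow> x r \<in> tensors K N I \<and> tensor_rank K N I (x r) \<le> 1"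
    and e0: "e 0 \<in> tensors K N I"
    and e: "\<And>r. r \<in> {1..R} \<Longrightarrow> e r = x r + e (r - 1) - \<phi> (x r + e (r - 1))"
  shows "r \<le> R \<Longrightarrow> e r \<in> tensors K N I \<and>
    tensor_norm N I (e r) \<le>
      (\<Prod>k=1..r. sin (tensor_angle N I (e (k - 1)) (x k))) * tensor_norm N I (e 0)"
proof (induction r)
  case 0
  show ?case using e0 by simp
next
  case (Suc r)
  define a where "a = sin (tensor_angle N I (e r) (x (Suc r)))"
  have x': "x (Suc r) \<in> tensors K N I" "tensor_rank K N I (x (Suc r)) \<le> 1"
    using x[of "Suc r"] Suc.prems by auto
  have er: "e r \<in> tensors K N I" using Suc by simp
  have y: "x (Suc r) + e r \<in> tensors K N I" by (rule tensors_add[OF K x'(1) er])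
  have e': "e (Suc r) = x (Suc r) + e r - \<phi> (x (Suc r) + e r)"
    using e[of "Suc r"] Suc.prems by simp
  have "\<phi> (x (Suc r) + e r) \<in> tensors K N I"
    using \<phi> y unfolding best_rank_one_operator_def by blast
  hence mem: "e (Suc r) \<in> tensors K N I"
    unfolding e' by (intro tensors_diff[OF K] y)
  have "tensor_norm N I (e (Suc r)) \<le> a * tensor_norm N I (e r)"
    unfolding e' a_def by (rule best_approximation_residual_le[OF K N \<phi> x' er])
  also have "\<dots> \<le> a * ((\<Prod>k=1..r. sin (tensor_angle N I (e (k - 1)) (x k))) * tensor_norm N I (e 0))"
    using Suc sin_tensor_angle_nonneg[OF er x'(1)] by (intro mult_left_mono) (auto simp: a_def)
  finally show ?case using mem by (simp add: a_def mult_ac)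
qed

lemma dcpd_initial_equations:
  assumes "dcpd \<phi> R T X Y E"
  shows "Y 1 1 = T"
    and "\<And>r. r \<in> {1..R} \<Longrightarrow> X r 1 = \<phi> (Y r 1)"
    and "\<And>r. 1 \<le> r \<Longrightarrow> r < R \<Longrightarrow> Y (Suc r) 1 = Y r 1 - X r 1"
    and "E R 1 = Y R 1 - X R 1"
  using assms unfolding dcpd_def Suc_eq_plus1 by simp_all

lemma dcpd_sweep_equations:
  assumes D: "dcpd \<phi> R T X Y E" and l: "l \<ge> 1"
  shows "Y 1 (Suc l) = X 1 l + E R l"
    and "\<And>r. 1 \<le> r \<Longrightarrow> r < R \<Longrightarrow> Y (Suc r) (Suc l) = X (Suc r) l + E r (Suc l)"
    and "\<And>r. r \<in> {1..R} \<Longrightarrow> X r (Suc l) = \<phi> (Y r (Suc l))"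
    and "\<And>r. r \<in> {1..R} \<Longrightarrow> E r (Suc l) = Y r (Suc l) - X r (Suc l)"
proof -
  have l2: "Suc l \<ge> 2" using l by simp
  have "\<forall>l\<ge>2. Y 1 l = X 1 (l - 1) + E R (l - 1)"
    and Y: "\<forall>l\<ge>2. \<forall>r\<in>{2..R}. Y r l = X r (l - 1) + E (r - 1) l"
    and XE: "\<forall>l\<ge>2. \<forall>r\<in>{1..R}. X r l = \<phi> (Y r l) \<and> E r l = Y r l - X r l"
    using D unfolding dcpd_def by blast+
  from this(1)[rule_format, OF l2] show "Y 1 (Suc l) = X 1 l + E R l"
    by (simp only: diff_Suc_1)
  show "Y (Suc r) (Suc l) = X (Suc r) l + E r (Suc l)" if "1 \<le> r" "r < R" for r
    using Y[rule_format, OF l2, of "Suc r"] that by (simp only: diff_Suc_1) simp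
  show "X r (Suc l) = \<phi> (Y r (Suc l))" "E r (Suc l) = Y r (Suc l) - X r (Suc l)"
    if "r \<in> {1..R}" for r
    using XE[rule_format, OF l2 that] by blast+
qed

text \<open>The state between two sweeps: the data required to start the next one.\<close>

lemma dcpd_invariant:
  assumes K: "K = \<real> \<or> K = UNIV" and R: "R \<ge> 1" and T: "T \<in> tensors K N I"
    and \<phi>: "best_rank_one_operator K N I \<phi>" and D: "dcpd \<phi> R T X Y E" and l: "l \<ge> 1"
  shows "E R l \<in> tensors K N I \<and>
    (\<forall>r\<in>{1..R}. X r l \<in> tensors K N I \<and> tensor_rank K N I (X r l) \<le> 1)"
proof -
  have \<phi>_mem: "\<phi> U \<in> tensors K N I" "tensor_rank K N I (\<phi> U) \<le> 1" if "U \<in> tensors K N I" for U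
    using \<phi> that unfolding best_rank_one_operator_def by blast+
  have R': "R \<in> {1..R}" using R by simp
  show ?thesis
    using l
  proof (induction l rule: dec_induct)
    case base
    note eqs = dcpd_initial_equations[OF D]
    have Y: "Y r 1 \<in> tensors K N I" if "1 \<le> r" "r \<le> R" for r
      using that
    proof (induction r rule: dec_induct)
      case base
      show ?case unfolding eqs(1) by (rule T)
    next
      case (step r)
      hence "Y r 1 \<in> tensors K N I" "r \<in> {1..R}" "r < R" by simp_all
      thus ?case
        unfolding eqs(3)[OF step.hyps(1) \<open>r < R\<close>] eqs(2)[OF \<open>r \<in> {1..R}\<close>]
        by (intro tensors_diff[OF K] \<phi>_mem)
    qed
    have X: "X r 1 \<in> tensors K N I \<and> tensor_rank K N I (X r 1) \<le> 1" if "r \<in> {1..R}" for r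
      unfolding eqs(2)[OF that] using that by (intro conjI \<phi>_mem Y) auto
    moreover have "E R 1 \<in> tensors K N I"
      unfolding eqs(4) using X[OF R'] R by (intro tensors_diff[OF K] Y) auto
    ultimately show ?case by blast
  next
    case (step l)
    note eqs = dcpd_sweep_equations[OF D step.hyps(1)]
    have IH: "E R l \<in> tensors K N I" "\<And>r. r \<in> {1..R} \<Longrightarrow> X r l \<in> tensors K N I"
      using step.IH by blast+
    have Y: "Y r (Suc l) \<in> tensors K N I" if "1 \<le> r" "r \<le> R" for r
      using that
    proof (induction r rule: dec_induct)
      case base
      show ?case unfolding eqs(1) using R by (intro tensors_add[OF K] IH) auto
    next
      case (step r)
      hence r: "Y r (Suc l) \<in> tensors K N I" "r \<in> {1..R}" "r < R" "Suc r \<in> {1..R}"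
        by simp_all
      show ?case
        unfolding eqs(2)[OF step.hyps(1) r(3)] eqs(4)[OF r(2)] eqs(3)[OF r(2)]
        by (intro tensors_add[OF K] tensors_diff[OF K] \<phi>_mem IH r)
    qed
    have X: "X r (Suc l) \<in> tensors K N I \<and> tensor_rank K N I (X r (Suc l)) \<le> 1"
      if "r \<in> {1..R}" for r
      unfolding eqs(3)[OF that] using that by (intro conjI \<phi>_mem Y) auto
    moreover have "E R (Suc l) \<in> tensors K N I"
      unfolding eqs(4)[OF R'] using X[OF R'] R by (intro tensors_diff[OF K] Y) auto
    ultimately show ?case by blast
  qed
qed

theorem corollaryV3:
  fixes K :: "complex set" and N :: nat and I :: "nat \<Rightarrow> nat" and R l :: nat
    and T :: tensor and \<phi> :: "tensor \<Rightarrow> tensor"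
    and X Y E :: "nat \<Rightarrow> nat \<Rightarrow> tensor" and c :: real
  assumes "K = \<real> \<or> K = UNIV"
    and "N \<ge> 1" and "\<forall>n\<in>{1..N}. I n \<ge> 1" and "R \<ge> 1"
    and "T \<in> tensors K N I"
    and "best_rank_one_operator K N I \<phi>"
    and "dcpd \<phi> R T X Y E"
    and "l > 1"
    and "c = (\<Prod>r=1..R. sin (dcpd_angle N I R X E r l))"
  shows "tensor_norm N I (E R l) \<le> c * tensor_norm N I (E R (l - 1))"
proof -
  note K = assms(1) and N = assms(2)
  obtain m where l: "l = Suc m" and m: "m \<ge> 1"
    using \<open>l > 1\<close> by (cases l) auto
  note eqs = dcpd_sweep_equations[OF assms(7) m]
  \<comment> \<open>The residual before the \<open>r\<close>-th update of sweep \<open>l\<close> is \<open>e (r - 1)\<close>; the first update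
    starts from what the previous sweep left.\<close>
  define e where "e = (\<lambda>r. if r = 0 then E R m else E r (Suc m))"
  have inv: "E R m \<in> tensors K N I"
    "\<And>r. r \<in> {1..R} \<Longrightarrow> X r m \<in> tensors K N I \<and> tensor_rank K N I (X r m) \<le> 1"
    using dcpd_invariant[OF K assms(4-7) m] by blast+
  have step: "e r = X r m + e (r - 1) - \<phi> (X r m + e (r - 1))" if r: "r \<in> {1..R}" for r
  proof -
    have Y: "Y r (Suc m) = X r m + e (r - 1)"
    proof (cases "r = 1")
      case True
      show ?thesis unfolding True eqs(1) by (simp add: e_def)
    next
      case False
      then obtain q where q: "r = Suc q" "1 \<le> q" "q < R" using r by (cases r) auto
      show ?thesis unfolding q(1) eqs(2)[OF q(2,3)] using q by (simp add: e_def)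
    qed
    have "e r = E r (Suc m)" using r by (simp add: e_def)
    thus ?thesis unfolding eqs(4)[OF r] eqs(3)[OF r] Y .
  qed
  have e0: "e 0 \<in> tensors K N I" using inv(1) by (simp add: e_def)
  have "tensor_norm N I (e R) \<le>
      (\<Prod>k=1..R. sin (tensor_angle N I (e (k - 1)) (X k m))) * tensor_norm N I (e 0)"
    by (rule sweep_residual_le[THEN conjunct2, OF K N assms(6) inv(2) e0 step order_refl])
  also have "(\<Prod>k=1..R. sin (tensor_angle N I (e (k - 1)) (X k m))) = c"
    unfolding assms(9) by (intro prod.cong refl) (auto simp: dcpd_angle_def e_def l)
  finally show ?thesis using \<open>R \<ge> 1\<close> by (simp add: e_def l)
qed

end
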